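(* Let $\Lambda/\Lambda_1/\cdots/\Lambda_{r-1}/\Lambda'$ be a self-similar binary lattice partition chain in $\mathbb R^n$, i.e. $\Lambda_\ell=T^\ell\Lambda$ for all $\ell$ (with $\Lambda_0=\Lambda$, $\Lambda_r=\Lambda'$), where $T=\alpha V$ for some scale factor $\alpha>1$ and orthogonal matrix $V$. Let the noise variance $\sigma^2>0$ per dimension be the same for all channels. Then, for $1\le\ell\le r-1$, the $\Lambda_{\ell-1}/\Lambda_\ell$ channel is (stochastically) degraded with respect to the $\Lambda_\ell/\Lambda_{\ell+1}$ channel.
   Context: Lattices are full-rank discrete subgroups of $\mathbb R^n$. A binary lattice partition chain is a chain $\Lambda_0\supset\Lambda_1\supset\cdots\supset\Lambda_r$ with $|\Lambda_{\ell-1}/\Lambda_\ell|=2$ for each $\ell$. Fix $a_\ell\in\Lambda_{\ell-1}\setminus\Lambda_\ell$. The $\Lambda_{\ell-1}/\Lambda_\ell$ channel with noise variance $\sigma^2$ takes a bit $x\in\{0,1\}$, and outputs $(xa_\ell+E)\bmod\Lambda_\ell$, where $E$ is i.i.d. Gaussian noise of mean zero and variance $\sigma^2$ per dimension; equivalently its transition density on a fundamental region of $\Lambda_\ell$ is $\bar y\mapsto\sum_{\lambda\in\Lambda_\ell}(\sqrt{2\pi}\sigma)^{-n}\exp(-\|\bar y-xa_\ell-\lambda\|^2/(2\sigma^2))$. A channel $W_1:\mathcal X\to\mathcal Y_1$ is (stochastically) degraded with respect to $W_2:\mathcal X\to\mathcal Y_2$ if there is a channel (Markov kernel) $Q:\mathcal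 Y_2\to\mathcal Y_1$ with $W_1(y_1|x)=\sum_{y_2}W_2(y_2|x)Q(y_1|y_2)$ (integral for continuous alphabets) for all $x,y_1$. *)

theory Defs
  imports "HOL-Probability.Probability"
begin

definition is_lattice :: "(real^'n) set \<Rightarrow> bool" where
  "is_lattice L \<longleftrightarrow>
     0 \<in> L \<and> (\<forall>x\<in>L. \<forall>y\<in>L. x - y \<in> L) \<and> topological_space_class.discrete L \<and> span L = UNIV"

(* The number of cosets x + M with x in L; meaningful for M a subgroup of L. *)
definition lattice_index :: "(real^'n) set \<Rightarrow> (real^'n) set \<Rightarrow> nat" where
  "lattice_index L M = card ((\<lambda>x. (+) x ` M) ` L)"

definition binary_partition_chain :: "(nat \<Rightarrow> (real^'n) set) \<Rightarrow> nat \<Rightarrow> bool" where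
  "binary_partition_chain L r \<longleftrightarrow>
     (\<forall>l\<le>r. is_lattice (L l)) \<and>
     (\<forall>l<r. L (Suc l) \<subset> L l \<and> lattice_index (L l) (L (Suc l)) = 2)"

definition self_similar_chain ::
    "real^'n^'n \<Rightarrow> (nat \<Rightarrow> (real^'n) set) \<Rightarrow> nat \<Rightarrow> bool" where
  "self_similar_chain T L r \<longleftrightarrow> (\<forall>l\<le>r. L l = ((*v) T ^^ l) ` L 0)"

definition fundamental_region :: "(real^'n) set \<Rightarrow> (real^'n) set \<Rightarrow> bool" where
  "fundamental_region L R \<longleftrightarrow> R \<in> sets borel \<and> (\<forall>x. \<exists>!y. y \<in> R \<and> x - y \<in> L)"

definition lattice_mod :: "(real^'n) set \<Rightarrow> (real^'n) set \<Rightarrow> real^'n \<Rightarrow> real^'n" where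
  "lattice_mod L R x = (THE y. y \<in> R \<and> x - y \<in> L)"

(* The components are independent normal variables with mean 0 and standard deviation s. *)
definition gaussian_noise :: "real \<Rightarrow> (real^'n) measure" where
  "gaussian_noise s = density lborel (\<lambda>e. ennreal (\<Prod>i\<in>UNIV. normal_density 0 s (e $ i)))"

lemma prod_normal_density:
  fixes e :: "real^'n"
  assumes "s > 0"
  shows "(\<Prod>i\<in>UNIV. normal_density 0 s (e $ i)) =
           exp (- (norm e)\<^sup>2 / (2 * s\<^sup>2)) / (sqrt (2 * pi) * s) ^ CARD('n)"
proof -
  have "(\<Sum>i\<in>UNIV. (e $ i)\<^sup>2) = (norm e)\<^sup>2"
    by (simp add: norm_vec_def L2_set_def sum_nonneg)
  then have "(\<Sum>i\<in>UNIV. - ((e $ i)\<^sup>2 / (2 * s\<^sup>2))) = - ((norm e)\<^sup>2 / (2 * s\<^sup>2))"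
    by (simp only: sum_negf flip: sum_divide_distrib)
  moreover have "sqrt (2 * pi * s\<^sup>2) = sqrt (2 * pi) * s"
    using assms by (simp add: real_sqrt_mult)
  ultimately show ?thesis
    by (simp add: normal_density_def prod_dividef flip: exp_sum)
qed

(* Only the lattice L modulo which the output is taken and the coset representative a enter;
   the output space is the Borel space on the fundamental region R of L. *)
definition mod_lattice_channel ::
    "(real^'n) set \<Rightarrow> (real^'n) set \<Rightarrow> real^'n \<Rightarrow> real \<Rightarrow> bool \<Rightarrow> (real^'n) measure" where
  "mod_lattice_channel L R a s x =
     distr (gaussian_noise s) (restrict_space borel R)
       (\<lambda>e. lattice_mod L R (of_bool x *\<^sub>R a + e))"

(* A channel with discrete input alphabet and output space N. *)
definition is_channel :: "'y measure \<Rightarrow> ('x \<Rightarrow> 'y measure) \<Rightarrow> bool" where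
  "is_channel N W \<longleftrightarrow> (\<forall>x. W x \<in> space (prob_algebra N))"

(* Arrows into prob_algebra N1 are exactly the Markov kernels from N2 to N1. *)
definition degraded ::
    "'y1 measure \<Rightarrow> ('x \<Rightarrow> 'y1 measure) \<Rightarrow> 'y2 measure \<Rightarrow> ('x \<Rightarrow> 'y2 measure) \<Rightarrow> bool" where
  "degraded N1 W1 N2 W2 \<longleftrightarrow>
     is_channel N1 W1 \<and> is_channel N2 W2 \<and>
     (\<exists>Q \<in> N2 \<rightarrow>\<^sub>M prob_algebra N1. \<forall>x. W1 x = W2 x \<bind> Q)"

end

theory Submission
  imports Defs
begin

text \<open>
  Applying \<open>T\<inverse>\<close> to the output of the \<open>\<Lambda>\<^sub>l/\<Lambda>\<^sub>l\<^sub>+\<^sub>1\<close> channel gives an output of the \<open>\<Lambda>\<^sub>l\<^sub>-\<^sub>1/\<Lambda>\<^sub>l\<close> channel whose noise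
  has the smaller variance \<open>(\<sigma>/\<alpha>)\<^sup>2\<close>: the Gaussian is rotation invariant, and \<open>T\<inverse>\<close> maps the coset of \<open>a\<^sub>l\<^sub>+\<^sub>1\<close>
  onto the coset of \<open>a\<^sub>l\<close>, because an index-two sublattice has only one nontrivial coset. The degrading
  kernel adds independent Gaussian noise of variance \<open>\<sigma>\<^sup>2 - (\<sigma>/\<alpha>)\<^sup>2\<close> and reduces modulo \<open>\<Lambda>\<^sub>l\<close> again.
\<close>

text \<open>The singletons of a discrete set form a relatively open cover, and a Lindelof subcover
  by singletons must contain every one of them. This makes a lattice countable, as the measurability
  of \<open>lattice_mod\<close> requires.\<close>

lemma countable_discrete_set:
  fixes S :: "'a::second_countable_topology set"
  assumes "topological_space_class.discrete S"
  shows "countable S"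
proof -
  have op: "openin (top_of_set S) {x}" if x: "x \<in> S" for x
  proof -
    obtain T where "open T" "T \<inter> S = {x}"
      using assms x unfolding topological_space_class.discrete_def topological_space_class.isolated_in_def
      by blast
    then show ?thesis
      by (metis inf.commute openin_open)
  qed
  obtain F where F: "F \<subseteq> (\<lambda>x. {x}) ` S" "countable F" "\<Union>F = \<Union>((\<lambda>x. {x}) ` S)"
  proof (rule Lindelof_openin)
    fix A assume "A \<in> (\<lambda>x. {x}) ` S"
    then show "openin (top_of_set S) A"
      using op by blast
  qed
  have "(\<lambda>x. {x}) ` S \<subseteq> F"
    using F(1,3) by blast
  then have "countable ((\<lambda>x. {x}) ` S)"
    using F(2) by (rule countable_subset)
  then show ?thesis
    by (rule countable_image_inj_on) simp
qed

section \<open>Gaussian noise: product structure and convolution\<close>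

lemma nn_integral_lborel_vec_prod:
  fixes f :: "'n::finite \<Rightarrow> real \<Rightarrow> ennreal"
  assumes [measurable]: "\<And>i. f i \<in> borel_measurable borel"
  shows "(\<integral>\<^sup>+(x::real^'n). (\<Prod>i\<in>UNIV. f i (x $ i)) \<partial>lborel) = (\<Prod>i\<in>UNIV. \<integral>\<^sup>+x. f i x \<partial>lborel)"
proof -
  \<comment> \<open>The map from an index to its axis vector is a bijection onto
    \<open>Basis\<close>; it turns the product over basis vectors into one over coordinates.\<close>
  have inj: "inj (\<lambda>i. axis i (1::real))"
    by (auto intro: injI simp: axis_eq_axis)
  have Basis: "(Basis :: (real^'n) set) = range (\<lambda>i. axis i 1)"
    by (auto simp: Basis_vec_def)
  have "(\<integral>\<^sup>+(x::real^'n). (\<Prod>b\<in>Basis. f (axis_index b) (x \<bullet> b)) \<partial>lborel) =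
      (\<Prod>b\<in>(Basis :: (real^'n) set). \<integral>\<^sup>+x. f (axis_index b) x \<partial>lborel)"
    by (rule nn_integral_lborel_prod) auto
  then show ?thesis
    by (simp add: Basis prod.reindex[OF inj] axis_index_axis inner_axis)
qed

lemma sets_gaussian_noise [measurable_cong, simp]: "sets (gaussian_noise s) = sets borel"
  by (simp add: gaussian_noise_def)

lemma space_gaussian_noise [simp]: "space (gaussian_noise s) = UNIV"
  by (simp add: gaussian_noise_def)

lemma measurable_prod_normal_density [measurable]:
  "(\<lambda>e::real^'n. \<Prod>i\<in>UNIV. normal_density m s (e $ i)) \<in> borel_measurable borel"
  by (intro borel_measurable_prod measurable_compose[OF _ borel_measurable_normal_density]
      borel_measurable_continuous_onI continuous_intros)

lemma prob_space_gaussian_noise: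
  assumes "s > 0"
  shows "prob_space (gaussian_noise s :: (real^'n) measure)"
proof -
  have "(\<integral>\<^sup>+x. ennreal (normal_density 0 s x) \<partial>lborel) = 1"
    using prob_space.emeasure_space_1[OF prob_space_normal_density[OF assms, of 0]]
    by (simp add: emeasure_density)
  then have "(\<integral>\<^sup>+(x::real^'n). ennreal (\<Prod>i\<in>UNIV. normal_density 0 s (x $ i)) \<partial>lborel) = 1"
    using nn_integral_lborel_vec_prod[of "\<lambda>i::'n. \<lambda>x. ennreal (normal_density 0 s x)"]
    by (simp add: prod_ennreal)
  then show ?thesis
    by (auto intro!: prob_spaceI simp: gaussian_noise_def emeasure_density)
qed

lemma nn_integral_gaussian_noise:
  assumes [measurable]: "f \<in> borel_measurable borel"
  shows "(\<integral>\<^sup>+x. f x \<partial>gaussian_noise s) =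
    (\<integral>\<^sup>+x. ennreal (\<Prod>i\<in>UNIV. normal_density 0 s (x $ i)) * f x \<partial>lborel)"
  unfolding gaussian_noise_def by (rule nn_integral_density) auto

text \<open>The integrand factorises over coordinates, so the convolution reduces to that of two
  centred normal densities on the line.\<close>

lemma nn_integral_prod_normal_density_conv:
  fixes x :: "real^'n"
  assumes "s > 0" "t > 0"
  shows "(\<integral>\<^sup>+y. ennreal (\<Prod>i\<in>UNIV. normal_density 0 s ((x - y) $ i)) *
      ennreal (\<Prod>i\<in>UNIV. normal_density 0 t (y $ i)) \<partial>lborel) =
    ennreal (\<Prod>i\<in>UNIV. normal_density 0 (sqrt (s\<^sup>2 + t\<^sup>2)) (x $ i))"
proof -
  have "(\<integral>\<^sup>+y. ennreal (\<Prod>i\<in>UNIV. normal_density 0 s ((x - y) $ i)) *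
      ennreal (\<Prod>i\<in>UNIV. normal_density 0 t (y $ i)) \<partial>lborel) =
    (\<integral>\<^sup>+(y::real^'n). (\<Prod>i\<in>UNIV. ennreal (normal_density 0 s (x $ i - y $ i) * normal_density 0 t (y $ i))) \<partial>lborel)"
    by (simp add: prod_ennreal prod.distrib prod_nonneg flip: ennreal_mult)
  also have "\<dots> = (\<Prod>i\<in>UNIV. \<integral>\<^sup>+z. ennreal (normal_density 0 s (x $ i - z) * normal_density 0 t z) \<partial>lborel)"
    by (rule nn_integral_lborel_vec_prod) measurable
  also have "\<dots> = (\<Prod>i\<in>UNIV. ennreal (normal_density 0 (sqrt (s\<^sup>2 + t\<^sup>2)) (x $ i)))"
    by (intro prod.cong refl fun_cong[OF conv_normal_density_zero_mean] assms)
  also have "\<dots> = ennreal (\<Prod>i\<in>UNIV. normal_density 0 (sqrt (s\<^sup>2 + t\<^sup>2)) (x $ i))"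
    by (simp add: prod_ennreal)
  finally show ?thesis .
qed

lemma nn_integral_lborel_translation:
  fixes f :: "'a::euclidean_space \<Rightarrow> ennreal"
  assumes [measurable]: "f \<in> borel_measurable borel"
  shows "(\<integral>\<^sup>+x. f (x + t) \<partial>lborel) = (\<integral>\<^sup>+x. f x \<partial>lborel)"
  by (subst (2) lborel_affine[of 1 t]) (simp_all add: nn_integral_density nn_integral_distr add.commute)

text \<open>Independent centred Gaussians add their variances: substitute \<open>x = u + v\<close>
  for fixed \<open>u\<close>, exchange the integrals, and recognise the convolution of the
  densities.\<close>

lemma nn_integral_gaussian_noise_add:
  fixes f :: "real^'n \<Rightarrow> ennreal"
  assumes [measurable]: "f \<in> borel_measurable borel" and "s > 0" "t > 0"
  shows "(\<integral>\<^sup>+u. \<integral>\<^sup>+v. f (u + v) \<partial>gaussian_noise s \<partial>gaussian_noise t) =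
    (\<integral>\<^sup>+x. f x \<partial>gaussian_noise (sqrt (s\<^sup>2 + t\<^sup>2)))"
proof -
  let ?p = "\<lambda>s x::real^'n. ennreal (\<Prod>i\<in>UNIV. normal_density 0 s (x $ i))"
  have [measurable]: "?p s \<in> borel_measurable borel" for s
    by measurable
  have "(\<integral>\<^sup>+u. \<integral>\<^sup>+v. f (u + v) \<partial>gaussian_noise s \<partial>gaussian_noise t) =
      (\<integral>\<^sup>+u. \<integral>\<^sup>+v. ?p t u * (?p s v * f (u + v)) \<partial>lborel \<partial>lborel)"
    by (simp add: nn_integral_gaussian_noise nn_integral_cmult)
  also have "\<dots> = (\<integral>\<^sup>+u. \<integral>\<^sup>+x. ?p t u * (?p s (x - u) * f x) \<partial>lborel \<partial>lborel)"
  proof (rule nn_integral_cong)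
    fix u :: "real^'n"
    show "(\<integral>\<^sup>+v. ?p t u * (?p s v * f (u + v)) \<partial>lborel) = (\<integral>\<^sup>+x. ?p t u * (?p s (x - u) * f x) \<partial>lborel)"
      using nn_integral_lborel_translation[of "\<lambda>x. ?p t u * (?p s (x - u) * f x)" u]
      by (simp add: add.commute)
  qed
  also have "\<dots> = (\<integral>\<^sup>+x. \<integral>\<^sup>+u. ?p t u * (?p s (x - u) * f x) \<partial>lborel \<partial>lborel)"
    by (rule lborel_pair.Fubini') measurable
  also have "\<dots> = (\<integral>\<^sup>+x. (\<integral>\<^sup>+u. ?p s (x - u) * ?p t u \<partial>lborel) * f x \<partial>lborel)"
    by (subst nn_integral_multc[symmetric]) (auto simp: mult_ac)
  also have "\<dots> = (\<integral>\<^sup>+x. f x \<partial>gaussian_noise (sqrt (s\<^sup>2 + t\<^sup>2)))"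
    by (simp only: nn_integral_prod_normal_density_conv[OF assms(2,3)] nn_integral_gaussian_noise assms(1))
  finally show ?thesis .
qed

section \<open>Orthogonal maps and scaling\<close>

lemma borel_measurable_matrix_vector_mult [measurable]:
  fixes A :: "real^'n^'m"
  shows "(*v) A \<in> borel_measurable borel"
  by (intro borel_measurable_continuous_onI linear_continuous_on)
    (simp add: linear_conv_bounded_linear[symmetric])

lemma norm_orthogonal_matrix:
  fixes Q :: "real^'n^'n"
  assumes "orthogonal_matrix Q"
  shows "norm (Q *v x) = norm x"
  using assms orthogonal_transformation_matrix[of "(*v) Q"] orthogonal_transformation_norm by auto

text \<open>
  Uniqueness of Haar measure in disguise: convolve with a radial weight \<open>p\<close> of total mass \<open>1\<close> (a Gaussian)
  and use only translation invariance and Fubini. The library's \<open>measure_linear_image\<close> is stated for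
  well-ordered index types, so it does not apply to an arbitrary finite index type.
\<close>

lemma nn_integral_lborel_orthogonal:
  fixes Q :: "real^'n^'n" and f :: "real^'n \<Rightarrow> ennreal"
  assumes Q: "orthogonal_matrix Q" and [measurable]: "f \<in> borel_measurable borel"
  shows "(\<integral>\<^sup>+x. f (Q *v x) \<partial>lborel) = (\<integral>\<^sup>+x. f x \<partial>lborel)"
proof -
  define p where "p x = ennreal (\<Prod>i\<in>UNIV. normal_density 0 1 (x $ i))" for x :: "real^'n"
  have [measurable]: "p \<in> borel_measurable borel"
    unfolding p_def by measurable
  have p_norm: "p x = p y" if "norm x = norm y" for x y
    using that by (simp add: p_def prod_normal_density)
  have p_int: "(\<integral>\<^sup>+x. p x \<partial>lborel) = 1"
    using prob_space.emeasure_space_1[OF prob_space_gaussian_noise[of 1, where 'n='n]]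
    by (simp add: gaussian_noise_def emeasure_density p_def)
  let ?Q' = "transpose Q"
  have QQ': "Q *v (?Q' *v y) = y" for y
    using Q by (simp only: orthogonal_matrix_def matrix_vector_mul_assoc matrix_vector_mul_lid)
  \<comment> \<open>Translating \<open>x\<close> by \<open>?Q' *v y\<close> moves its image under
    \<open>Q\<close> by exactly \<open>y\<close>.\<close>
  have shift: "(\<integral>\<^sup>+x. f (Q *v x) \<partial>lborel) = (\<integral>\<^sup>+x. f (Q *v x + y) \<partial>lborel)" for y
    using nn_integral_lborel_translation[of "\<lambda>x. f (Q *v x)" "?Q' *v y"]
    by (simp add: matrix_vector_right_distrib QQ' del: transpose_matrix_vector)
  have "(\<integral>\<^sup>+x. f (Q *v x) \<partial>lborel) = (\<integral>\<^sup>+y. p y * (\<integral>\<^sup>+x. f (Q *v x) \<partial>lborel) \<partial>lborel)"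
    by (simp add: nn_integral_multc p_int)
  also have "\<dots> = (\<integral>\<^sup>+y. \<integral>\<^sup>+x. p y * f (Q *v x + y) \<partial>lborel \<partial>lborel)"
    by (subst nn_integral_cmult) (auto simp flip: shift)
  also have "\<dots> = (\<integral>\<^sup>+x. \<integral>\<^sup>+y. p y * f (Q *v x + y) \<partial>lborel \<partial>lborel)"
    by (rule lborel_pair.Fubini') measurable
  also have "\<dots> = (\<integral>\<^sup>+x. \<integral>\<^sup>+y. p (y - Q *v x) * f y \<partial>lborel \<partial>lborel)"
  proof (rule nn_integral_cong)
    fix x
    show "(\<integral>\<^sup>+y. p y * f (Q *v x + y) \<partial>lborel) = (\<integral>\<^sup>+y. p (y - Q *v x) * f y \<partial>lborel)"
      using nn_integral_lborel_translation[of "\<lambda>y. p (y - Q *v x) * f y" "Q *v x"]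
      by (simp add: add.commute)
  qed
  also have "\<dots> = (\<integral>\<^sup>+y. \<integral>\<^sup>+x. p (y - Q *v x) * f y \<partial>lborel \<partial>lborel)"
    by (rule lborel_pair.Fubini') measurable
  also have "\<dots> = (\<integral>\<^sup>+y. (\<integral>\<^sup>+x. p (x + - (?Q' *v y)) \<partial>lborel) * f y \<partial>lborel)"
  proof (rule nn_integral_cong)
    fix y
    \<comment> \<open>Radiality moves \<open>Q\<close> from \<open>x\<close> to \<open>y\<close>;
      the inner integral over \<open>x\<close> is then a translate of the integral of
      \<open>p\<close>, hence 1.\<close>
    have "p (y - Q *v x) = p (x + - (?Q' *v y))" for x
    proof (rule p_norm)
      have "norm (y - Q *v x) = norm (Q *v (x - ?Q' *v y))"
        by (simp add: matrix_vector_mult_diff_distrib QQ' norm_minus_commute del: transpose_matrix_vector)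
      then show "norm (y - Q *v x) = norm (x + - (?Q' *v y))"
        by (simp add: norm_orthogonal_matrix[OF Q])
    qed
    then show "(\<integral>\<^sup>+x. p (y - Q *v x) * f y \<partial>lborel) = (\<integral>\<^sup>+x. p (x + - (?Q' *v y)) \<partial>lborel) * f y"
      by (simp add: nn_integral_multc)
  qed
  also have "\<dots> = (\<integral>\<^sup>+y. f y \<partial>lborel)"
    by (simp only: nn_integral_lborel_translation \<open>p \<in> borel_measurable borel\<close> p_int mult_1)
  finally show ?thesis .
qed

text \<open>The density depends only on the norm, so an orthogonal map preserves it and only the
  scaling by \<open>c\<close> changes the deviation.\<close>

lemma distr_gaussian_noise_orthogonal:
  fixes Q :: "real^'n^'n"
  assumes Q: "orthogonal_matrix Q" and c: "c > 0" and s: "s > 0"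
  shows "distr (gaussian_noise s) borel (\<lambda>x. c *\<^sub>R (Q *v x)) = gaussian_noise (c * s)"
proof (rule measure_eqI)
  let ?f = "\<lambda>x. c *\<^sub>R (Q *v x)"
  let ?p = "\<lambda>s x::real^'n. \<Prod>i\<in>UNIV. normal_density 0 s (x $ i)"
  \<comment> \<open>The factor \<open>c ^ CARD('n)\<close> is the Jacobian of the scaling; the
    affine substitution in \<open>lborel\<close> below absorbs it.\<close>
  have p: "?p s x = c ^ CARD('n) * ?p (c * s) (?f x)" for x
    unfolding prod_normal_density[OF s] prod_normal_density[OF mult_pos_pos[OF c s]]
    using c s by (simp add: norm_orthogonal_matrix[OF Q] power_mult_distrib)
  fix A assume "A \<in> sets (distr (gaussian_noise s) borel ?f)"
  then have [measurable]: "A \<in> sets borel"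
    by simp
  let ?g = "\<lambda>x. ennreal (c ^ CARD('n)) * (ennreal (?p (c * s) (c *\<^sub>R x)) * indicator A (c *\<^sub>R x))"
  have [measurable]: "?f \<in> borel_measurable borel"
    by measurable
  have [measurable]: "(\<lambda>x. ?p t (c *\<^sub>R x)) \<in> borel_measurable borel" for t
    using measurable_compose[OF _ measurable_prod_normal_density, of "\<lambda>x. c *\<^sub>R x" borel 0 t] by simp
  have "emeasure (distr (gaussian_noise s) borel ?f) A = (\<integral>\<^sup>+x. indicator A (?f x) \<partial>gaussian_noise s)"
    using nn_integral_distr[of ?f "gaussian_noise s" borel "indicator A"] by simp
  also have "\<dots> = (\<integral>\<^sup>+x. ennreal (?p s x) * indicator A (?f x) \<partial>lborel)"
    by (rule nn_integral_gaussian_noise) measurable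
  also have "\<dots> = (\<integral>\<^sup>+x. ?g (Q *v x) \<partial>lborel)"
    using c by (simp only: p) (simp add: ennreal_mult prod_nonneg mult.assoc)
  also have "\<dots> = (\<integral>\<^sup>+x. ?g x \<partial>lborel)"
    by (rule nn_integral_lborel_orthogonal[OF Q]) measurable
  also have "\<dots> = (\<integral>\<^sup>+x. ennreal (?p (c * s) x) * indicator A x \<partial>lborel)"
    using c by (subst (2) lborel_affine[of c 0])
      (simp_all add: nn_integral_density nn_integral_distr)
  also have "\<dots> = emeasure (gaussian_noise (c * s)) A"
    by (simp add: gaussian_noise_def emeasure_density)
  finally show "emeasure (distr (gaussian_noise s) borel ?f) A = emeasure (gaussian_noise (c * s)) A" .
qed simp

section \<open>Reduction modulo a lattice\<close>

lemma lattice_mod_mem: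
  assumes "fundamental_region L R"
  shows "lattice_mod L R x \<in> R" "x - lattice_mod L R x \<in> L"
  using assms theI'[of "\<lambda>y. y \<in> R \<and> x - y \<in> L"] by (auto simp: fundamental_region_def lattice_mod_def)

lemma lattice_mod_unique:
  assumes "fundamental_region L R" "y \<in> R" "x - y \<in> L"
  shows "lattice_mod L R x = y"
  using assms lattice_mod_mem[OF assms(1), of x] by (auto simp: fundamental_region_def)

lemma is_lattice_minus: "is_lattice L \<Longrightarrow> x \<in> L \<Longrightarrow> - x \<in> L"
  unfolding is_lattice_def by (metis diff_0)

lemma is_lattice_add: "is_lattice L \<Longrightarrow> x \<in> L \<Longrightarrow> y \<in> L \<Longrightarrow> x + y \<in> L"
  using is_lattice_minus[of L y] unfolding is_lattice_def by (metis diff_minus_eq_add)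

lemma lattice_mod_cong:
  assumes "is_lattice L" "fundamental_region L R" "x - y \<in> L"
  shows "lattice_mod L R x = lattice_mod L R y"
  using is_lattice_add[OF assms(1) assms(3) lattice_mod_mem(2)[OF assms(2), of y]]
  by (intro lattice_mod_unique assms lattice_mod_mem) simp

text \<open>The preimage of a Borel set \<open>A\<close> inside \<open>R\<close> is the union of the
  translates of \<open>A\<close> by lattice points, a countable union of Borel sets.\<close>

lemma measurable_lattice_mod:
  assumes L: "is_lattice L" and R: "fundamental_region L R"
  shows "lattice_mod L R \<in> borel \<rightarrow>\<^sub>M restrict_space borel R"
proof (rule measurableI)
  fix A assume "A \<in> sets (restrict_space borel R)"
  then have A: "A \<in> sets borel" "A \<subseteq> R"
    using R by (auto simp: sets_restrict_space_iff fundamental_region_def)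
  have "lattice_mod L R -` A \<inter> space borel = (\<Union>z\<in>L. (\<lambda>x. x - z) -` A)"
  proof (intro equalityI subsetI)
    fix x assume "x \<in> lattice_mod L R -` A \<inter> space borel"
    then show "x \<in> (\<Union>z\<in>L. (\<lambda>x. x - z) -` A)"
      by (intro UN_I[OF lattice_mod_mem(2)[OF R, of x]]) simp
  next
    fix x assume "x \<in> (\<Union>z\<in>L. (\<lambda>x. x - z) -` A)"
    then obtain z where "z \<in> L" "x - z \<in> A"
      by auto
    with A lattice_mod_unique[OF R, of "x - z" x] show "x \<in> lattice_mod L R -` A \<inter> space borel"
      by auto
  qed
  moreover have "countable L"
    using L by (auto simp: is_lattice_def intro: countable_discrete_set)
  moreover have "(\<lambda>x. x - z) -` A \<in> sets borel" for z
    using A by (intro measurable_sets_borel[of _ borel]) auto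
  ultimately show "lattice_mod L R -` A \<inter> space borel \<in> sets borel"
    by auto
qed (use lattice_mod_mem(1)[OF R] in \<open>auto simp: space_restrict_space\<close>)

section \<open>Gaussian noise as a Markov kernel\<close>

lemma measurable_distr_gaussian_noise_add:
  fixes h :: "real^'n \<Rightarrow> 'a"
  assumes [measurable]: "h \<in> borel \<rightarrow>\<^sub>M N" and "s > 0"
  shows "(\<lambda>u. distr (gaussian_noise s) N (\<lambda>v. h (u + v))) \<in> borel \<rightarrow>\<^sub>M prob_algebra N"
proof (rule measurable_prob_algebraI)
  interpret prob_space "gaussian_noise s :: (real^'n) measure"
    by (rule prob_space_gaussian_noise) fact
  show "prob_space (distr (gaussian_noise s) N (\<lambda>v. h (u + v)))" for u
    by (rule prob_space_distr) measurable
  show "(\<lambda>u. distr (gaussian_noise s) N (\<lambda>v. h (u + v))) \<in> borel \<rightarrow>\<^sub>M subprob_algebra N"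
    by (rule measurable_distr2[where M=borel])
      (measurable, use M_in_subprob in \<open>simp cong: subprob_algebra_cong\<close>)
qed

text \<open>Kernel form of the addition of variances, used to merge the fresh noise of the degrading
  kernel with the shrunken channel noise.\<close>

lemma bind_gaussian_noise_add:
  fixes h :: "real^'n \<Rightarrow> 'a"
  assumes [measurable]: "h \<in> borel \<rightarrow>\<^sub>M N" and "s > 0" "t > 0"
  shows "gaussian_noise t \<bind> (\<lambda>u. distr (gaussian_noise s) N (\<lambda>v. h (u + v))) =
    distr (gaussian_noise (sqrt (s\<^sup>2 + t\<^sup>2))) N h"
proof (rule measure_eqI)
  have [measurable]: "(\<lambda>u. distr (gaussian_noise s) N (\<lambda>v. h (u + v))) \<in> gaussian_noise t \<rightarrow>\<^sub>M subprob_algebra N"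
    using measurable_prob_algebraD[OF measurable_distr_gaussian_noise_add[OF assms(1,2)]] by simp
  show "sets (gaussian_noise t \<bind> (\<lambda>u. distr (gaussian_noise s) N (\<lambda>v. h (u + v)))) =
      sets (distr (gaussian_noise (sqrt (s\<^sup>2 + t\<^sup>2))) N h)"
    by (subst sets_bind[of _ _ N]) auto
  fix A assume "A \<in> sets (gaussian_noise t \<bind> (\<lambda>u. distr (gaussian_noise s) N (\<lambda>v. h (u + v))))"
  then have [measurable]: "A \<in> sets N"
    by (subst (asm) sets_bind[of _ _ N]) auto
  have "emeasure (gaussian_noise t \<bind> (\<lambda>u. distr (gaussian_noise s) N (\<lambda>v. h (u + v)))) A =
      (\<integral>\<^sup>+u. emeasure (distr (gaussian_noise s) N (\<lambda>v. h (u + v))) A \<partial>gaussian_noise t)"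
    by (rule emeasure_bind[where N=N]) auto
  also have "\<dots> = (\<integral>\<^sup>+u. \<integral>\<^sup>+v. indicator A (h (u + v)) \<partial>gaussian_noise s \<partial>gaussian_noise t)"
    by (intro nn_integral_cong) (simp add: nn_integral_distr flip: nn_integral_indicator)
  also have "\<dots> = (\<integral>\<^sup>+x. indicator A (h x) \<partial>gaussian_noise (sqrt (s\<^sup>2 + t\<^sup>2)))"
    by (rule nn_integral_gaussian_noise_add) (use assms in auto)
  also have "\<dots> = emeasure (distr (gaussian_noise (sqrt (s\<^sup>2 + t\<^sup>2))) N h) A"
    by (simp add: nn_integral_distr flip: nn_integral_indicator)
  finally show "emeasure (gaussian_noise t \<bind> (\<lambda>u. distr (gaussian_noise s) N (\<lambda>v. h (u + v)))) A =
      emeasure (distr (gaussian_noise (sqrt (s\<^sup>2 + t\<^sup>2))) N h) A" .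
qed

section \<open>Cosets and degradation of lattice channels\<close>

lemma is_channel_mod_lattice_channel:
  assumes "is_lattice L" "fundamental_region L R" "s > 0"
  shows "is_channel (restrict_space borel R) (mod_lattice_channel L R a s)"
proof -
  note [measurable] = measurable_lattice_mod[OF assms(1,2)]
  have "prob_space (mod_lattice_channel L R a s x)" for x
    unfolding mod_lattice_channel_def
    by (rule prob_space.prob_space_distr[OF prob_space_gaussian_noise[OF assms(3)]]) measurable
  then show ?thesis
    by (simp add: is_channel_def space_prob_algebra mod_lattice_channel_def)
qed

text \<open>Otherwise \<open>0\<close>, \<open>a\<close> and \<open>b\<close> would represent three
  distinct cosets of \<open>M\<close>.\<close>

lemma diff_mem_of_lattice_index_2:
  assumes M: "is_lattice M" and index: "lattice_index L M = 2" and "0 \<in> L"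
    and a: "a \<in> L - M" and b: "b \<in> L - M"
  shows "a - b \<in> M"
proof (rule ccontr)
  assume ab: "a - b \<notin> M"
  let ?C = "\<lambda>x. (+) x ` M"
  have eqD: "x - y \<in> M" if "?C x = ?C y" for x y
  proof -
    have "x + 0 \<in> ?C y"
      using M that by (metis image_eqI is_lattice_def)
    then show ?thesis
      by auto
  qed
  have "?C a \<noteq> ?C b" "?C a \<noteq> ?C 0" "?C b \<noteq> ?C 0"
    using eqD[of a b] eqD[of a 0] eqD[of b 0] a b ab by auto
  then have "card {?C 0, ?C a, ?C b} = 3"
    by (metis card_3_iff)
  moreover have "card {?C 0, ?C a, ?C b} \<le> card (?C ` L)"
  proof (rule card_mono)
    \<comment> \<open>An infinite set has \<open>card\<close> 0, so index 2 also gives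
      finiteness.\<close>
    show "finite (?C ` L)"
      using index by (intro card_ge_0_finite) (simp add: lattice_index_def)
    show "{?C 0, ?C a, ?C b} \<subseteq> ?C ` L"
      using a b \<open>0 \<in> L\<close> by blast
  qed
  ultimately show False
    using index by (simp add: lattice_index_def)
qed

text \<open>The core for two lattices: a contracting similarity that carries \<open>L'\<close> into
  \<open>L\<close> and \<open>a'\<close> into the coset of \<open>a\<close> yields the
  degradation.\<close>

lemma degraded_similar_lattice:
  fixes Q :: "real^'n^'n"
  assumes L: "is_lattice L" "fundamental_region L R"
    and L': "is_lattice L'" "fundamental_region L' R'"
    and Q: "orthogonal_matrix Q" and c: "0 < c" "c < 1"
    and sub: "\<And>z. z \<in> L' \<Longrightarrow> c *\<^sub>R (Q *v z) \<in> L"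
    and a: "c *\<^sub>R (Q *v a') - a \<in> L" and s: "s > 0"
  shows "degraded (restrict_space borel R) (mod_lattice_channel L R a s)
    (restrict_space borel R') (mod_lattice_channel L' R' a' s)"
proof -
  define f where "f x = c *\<^sub>R (Q *v x)" for x
  have [measurable]: "f \<in> borel_measurable borel"
    unfolding f_def by measurable
  have f_add: "f (x + y) = f x + f y" and f_diff: "f (x - y) = f x - f y"
    and f_scale: "f (k *\<^sub>R x) = k *\<^sub>R f x" for x y k
    by (simp_all add: f_def matrix_vector_right_distrib matrix_vector_mult_diff_distrib
        scaleR_right_distrib scaleR_right_diff_distrib matrix_vector_mult_scaleR)
  \<comment> \<open>The contraction leaves noise of variance \<open>(c * s)\<^sup>2\<close>;
    \<open>t\<close> supplies the variance missing from \<open>s\<^sup>2\<close>.\<close>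
  define t where "t = s * sqrt (1 - c\<^sup>2)"
  have c2: "c\<^sup>2 < 1"
    using c by (simp add: power_less_one_iff)
  then have t: "t > 0"
    using s by (simp add: t_def)
  have "t\<^sup>2 + (c * s)\<^sup>2 = s\<^sup>2"
    using c2 by (simp add: t_def power_mult_distrib algebra_simps)
  then have st: "sqrt (t\<^sup>2 + (c * s)\<^sup>2) = s"
    using s by simp
  let ?N = "restrict_space borel R" and ?N' = "restrict_space borel R'"
  note [measurable] = measurable_lattice_mod[OF L] measurable_lattice_mod[OF L']
  define K where "K y = distr (gaussian_noise t) ?N (\<lambda>v. lattice_mod L R (f y + v))" for y
  have K: "K \<in> ?N' \<rightarrow>\<^sub>M prob_algebra ?N"
    unfolding K_def
    by (rule measurable_compose[OF _ measurable_distr_gaussian_noise_add[OF _ t]])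
      (auto intro: measurable_restrict_space1 measurable_lattice_mod[OF L])
  have "mod_lattice_channel L R a s x = mod_lattice_channel L' R' a' s x \<bind> K" for x
  proof -
    let ?b = "of_bool x :: real"
    \<comment> \<open>\<open>k\<close> describes the same output as a function of the contracted
      noise \<open>u\<close> alone, with no reduction modulo \<open>L'\<close> in between.\<close>
    define k where "k u = distr (gaussian_noise t) ?N (\<lambda>v. lattice_mod L R (?b *\<^sub>R a + (u + v)))" for u
    have k [measurable]: "k \<in> borel \<rightarrow>\<^sub>M subprob_algebra ?N"
      unfolding k_def using t
      by (intro measurable_prob_algebraD measurable_distr_gaussian_noise_add[of "\<lambda>z. lattice_mod L R (?b *\<^sub>R a + z)"]) measurable
    \<comment> \<open>Reducing modulo \<open>L'\<close> first changes the argument by a point of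
      \<open>L'\<close>, which \<open>f\<close> sends into \<open>L\<close>; replacing
      \<open>f a'\<close> by \<open>a\<close> also costs a point of \<open>L\<close>. The final
      reduction removes both.\<close>
    have eq: "K (lattice_mod L' R' (?b *\<^sub>R a' + e)) = k (f e)" for e
    proof -
      let ?y = "lattice_mod L' R' (?b *\<^sub>R a' + e)"
      have "- f (?b *\<^sub>R a' + e - ?y) \<in> L"
        using sub[OF lattice_mod_mem(2)[OF L'(2)]] is_lattice_minus[OF L(1)] by (simp add: f_def)
      moreover have "?b *\<^sub>R (f a' - a) \<in> L"
        using a L(1) by (cases x) (auto simp: f_def is_lattice_def)
      ultimately have "- f (?b *\<^sub>R a' + e - ?y) + ?b *\<^sub>R (f a' - a) \<in> L"
        by (rule is_lattice_add[OF L(1)])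
      then have "(f ?y + v) - (?b *\<^sub>R a + (f e + v)) \<in> L" for v
        by (simp add: f_add f_diff f_scale algebra_simps)
      then show ?thesis
        unfolding K_def k_def by (intro distr_cong lattice_mod_cong[OF L]) auto
    qed
    have "mod_lattice_channel L' R' a' s x \<bind> K = gaussian_noise s \<bind> (\<lambda>e. k (f e))"
      unfolding mod_lattice_channel_def
      by (subst bind_distr[OF _ measurable_prob_algebraD[OF K]]) (auto simp: eq)
    also have "\<dots> = distr (gaussian_noise s) borel f \<bind> k"
      by (rule bind_distr[symmetric, OF _ k]) auto
    also have "\<dots> = gaussian_noise (c * s) \<bind> k"
      unfolding f_def by (simp add: distr_gaussian_noise_orthogonal[OF Q c(1) s])
    also have "\<dots> = mod_lattice_channel L R a s x"
      unfolding k_def mod_lattice_channel_def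
      by (subst bind_gaussian_noise_add[where h="\<lambda>z. lattice_mod L R (?b *\<^sub>R a + z)"])
        (use t c s in \<open>simp_all add: st\<close>)
    finally show ?thesis ..
  qed
  then show ?thesis
    using K is_channel_mod_lattice_channel[OF L s] is_channel_mod_lattice_channel[OF L' s]
    unfolding degraded_def by blast
qed

theorem lemma3:
  fixes L :: "nat \<Rightarrow> (real^'n) set"
    and R :: "nat \<Rightarrow> (real^'n) set"
    and a :: "nat \<Rightarrow> real^'n"
    and V :: "real^'n^'n"
    and \<alpha> \<sigma> :: real
    and r l :: nat
  assumes "binary_partition_chain L r"
    and "\<alpha> > 1"
    and "orthogonal_matrix V"
    and "self_similar_chain (\<alpha> *\<^sub>R V) L r"
    and "\<And>k. 1 \<le> k \<Longrightarrow> k \<le> r \<Longrightarrow> a k \<in> L (k - 1) - L k"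
    and "\<And>k. 1 \<le> k \<Longrightarrow> k \<le> r \<Longrightarrow> fundamental_region (L k) (R k)"
    and "\<sigma> > 0"
    and "1 \<le> l" and "l \<le> r - 1"
  shows "degraded
           (restrict_space borel (R l)) (mod_lattice_channel (L l) (R l) (a l) \<sigma>)
           (restrict_space borel (R (l + 1))) (mod_lattice_channel (L (l + 1)) (R (l + 1)) (a (l + 1)) \<sigma>)"
proof -
  let ?T = "(*v) (\<alpha> *\<^sub>R V)"
  \<comment> \<open>\<open>?S\<close> inverts \<open>?T\<close>, as the transpose of the orthogonal
    \<open>V\<close> is its inverse; it is the contraction fed to
    \<open>degraded_similar_lattice\<close>.\<close>
  let ?S = "\<lambda>z. (1 / \<alpha>) *\<^sub>R (transpose V *v z)"
  have ST: "?S (?T z) = z" for z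
  proof -
    have "?S (?T z) = transpose V *v (V *v z)"
      using assms(2) by (simp only: scaleR_matrix_vector_assoc[symmetric] matrix_vector_mult_scaleR) simp
    also have "\<dots> = z"
      using assms(3) by (simp only: orthogonal_matrix_def matrix_vector_mul_assoc matrix_vector_mul_lid)
    finally show ?thesis .
  qed
  have S_diff: "?S (x - y) = ?S x - ?S y" for x y
    by (simp only: matrix_vector_mult_diff_distrib scaleR_right_diff_distrib)
  \<comment> \<open>Subtraction is truncated: for \<open>r = 0\<close> it is
    \<open>1 \<le> l\<close> that contradicts \<open>l \<le> r - 1\<close>.\<close>
  have r: "l < r" "l - 1 < r"
    using assms(8,9) by auto
  have image: "L (Suc k) = ?T ` L k" if "k < r" for k
  proof -
    have "L m = (?T ^^ m) ` L 0" if "m \<le> r" for m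
      using assms(4) that unfolding self_similar_chain_def by blast
    from this[of k] this[of "Suc k"] that show ?thesis
      by (simp only: funpow.simps image_comp less_imp_le Suc_leI)
  qed
  have lat: "is_lattice (L k)" if "k \<le> r" for k
    using assms(1) that by (simp add: binary_partition_chain_def)
  have sub: "?S z \<in> L k" if "k < r" "z \<in> L (Suc k)" for k z
    using that ST by (auto simp: image)
  have a: "a l \<in> L (l - 1) - L l" "a (l + 1) \<in> L l - L (l + 1)"
    using assms(5)[of l] assms(5)[of "l + 1"] assms(8) r by auto
  \<comment> \<open>\<open>?T (a l)\<close> is thus another representative of the nontrivial coset
    containing \<open>a (l + 1)\<close>. Applying \<open>?S\<close> to their congruence modulo
    \<open>L (l + 1)\<close> gives the one modulo \<open>L l\<close> that the core lemma asks
    for.\<close>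
  have Ta: "?T (a l) \<in> L l - L (l + 1)"
  proof
    show "?T (a l) \<in> L l"
      \<comment> \<open>Since \<open>1 \<le> l\<close>, the successor of \<open>l - 1\<close> is
        \<open>l\<close>.\<close>
      using a(1) image[OF r(2)] assms(8) by auto
    show "?T (a l) \<notin> L (l + 1)"
    proof
      assume "?T (a l) \<in> L (l + 1)"
      then have "?S (?T (a l)) \<in> L l"
        using sub[OF r(1)] by simp
      with a(1) show False
        unfolding ST by simp
    qed
  qed
  have "a (l + 1) - ?T (a l) \<in> L (l + 1)"
    by (rule diff_mem_of_lattice_index_2[OF _ _ _ a(2) Ta])
      (use assms(1) r lat in \<open>auto simp: binary_partition_chain_def is_lattice_def\<close>)
  then have "?S (a (l + 1) - ?T (a l)) \<in> L l"
    using sub[OF r(1)] unfolding Suc_eq_plus1 by blast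
  then have "?S (a (l + 1)) - a l \<in> L l"
    unfolding S_diff ST .
  then show ?thesis
    using assms(2,3,6,7,8) r lat sub[OF r(1)]
    by (intro degraded_similar_lattice[where Q="transpose V" and c="1 / \<alpha>"]) auto
qed

end
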